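(* Let $B>0$. Suppose $p(B)=1$, and fix the scalar $\alpha=\alpha^*$ with $\alpha^*=\mathrm{logit}(q)/B$. Then $$D_{\mathrm{KL}}(\eta_t,\eta_c;\alpha^* )\le H_b(q)-H(\eta_c).$$
   Context: $\mathcal X$ is a domain with marginal probability distribution $\mathsf M$, $\mathcal Y=\{-1,1\}$, and $\eta_c,\eta_t:\mathcal X\to[0,1]$ are the clean and twisted posterior mappings (probability that $Y=1$ given $X=x$). $\mathrm{logit}(u)=\log(u/(1-u))$. For $B>0$, $\mathsf M(B)$ is $\mathsf M$ restricted to the support where almost surely $(1+\exp(B))^{-1}\le\eta_t(x)\le(1+\exp(-B))^{-1}$, and $p(B)\in[0,1]$ is the weight of this support in $\mathsf M$. $\mathsf D(B)$ is the distribution on $\mathcal X\times\mathcal Y$ induced by the marginal $\mathsf M(B)$ and the posterior $\eta_c$ (i.e. $X\sim\mathsf M(B)$, $\Pr[Y=1\mid X]=\eta_c(X)$). Define $$e=\frac1B\,\mathbb E_{(X,Y)\sim\mathsf D(B)}\big[Y\cdot\mathrm{logit}(\eta_t(X))\big]\in[-1,1],\qquad q=\frac{1+e}{2}\in[0,1].$$ The Bayes tilted estimate of the $\alpha$-loss is $t_{\ell^\alpha}(v)=\frac{v^\alpha}{v^\alpha+(1-v)^\alpha}$ (this formula is also used when $\alpha=0$). Define $$\mathrm{CE}(\eta_t,\eta_c;\alpha)=\mathbb E_{X\sim\mathsf M}\big[-\eta_c(X)\log t_{\ell^\alpha}(\eta_t(X))-(1-\eta_c(X))\log t_{\ell^\alpha}(1-\eta_t(X))\big],$$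 $H_b(u)=-u\log u-(1-u)\log(1-u)$, $H(\eta_c)=\mathbb E_{X\sim\mathsf M}[H_b(\eta_c(X))]$, and $D_{\mathrm{KL}}(\eta_t,\eta_c;\alpha)=\mathrm{CE}(\eta_t,\eta_c;\alpha)-H(\eta_c)$. *)

theory Defs
  imports "HOL-Probability.Probability" "HOL-Real_Asymp.Real_Asymp"
begin

definition logit :: "real \<Rightarrow> real" where
  "logit u = ln (u / (1 - u))"

definition clip_support :: "'a measure \<Rightarrow> ('a \<Rightarrow> real) \<Rightarrow> real \<Rightarrow> 'a set" where
  "clip_support M \<eta>t B =
     {x \<in> space M. inverse (1 + exp B) \<le> \<eta>t x \<and> \<eta>t x \<le> inverse (1 + exp (- B))}"

definition clip_weight :: "'a measure \<Rightarrow> ('a \<Rightarrow> real) \<Rightarrow> real \<Rightarrow> real" where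
  "clip_weight M \<eta>t B = measure M (clip_support M \<eta>t B)"

text \<open>The marginal conditioned on the support above; meaningful when its weight is positive.\<close>

definition clip_marginal :: "'a measure \<Rightarrow> ('a \<Rightarrow> real) \<Rightarrow> real \<Rightarrow> 'a measure" where
  "clip_marginal M \<eta>t B = uniform_measure M (clip_support M \<eta>t B)"

text \<open>The joint law of \<open>(X, Y)\<close>, with \<open>Y\<close> a real number in \<open>{-1, 1}\<close>, for marginal \<open>N\<close> and posterior
  \<open>\<eta>\<close>, given by its density with respect to \<open>N\<close> times counting measure;
  see \<open>emeasure_joint_law_pos\<close> and \<open>emeasure_joint_law_neg\<close> below.\<close>

definition joint_law :: "'a measure \<Rightarrow> ('a \<Rightarrow> real) \<Rightarrow> ('a \<times> real) measure" where
  "joint_law N \<eta> = density (N \<Otimes>\<^sub>M count_space {-1, 1})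
     (\<lambda>(x, y). ennreal (if y = 1 then \<eta> x else 1 - \<eta> x))"

definition edge ::
  "'a measure \<Rightarrow> ('a \<Rightarrow> real) \<Rightarrow> ('a \<Rightarrow> real) \<Rightarrow> real \<Rightarrow> real" where
  "edge M \<eta>c \<eta>t B =
     1 / B * (\<integral>z. snd z * logit (\<eta>t (fst z)) \<partial>joint_law (clip_marginal M \<eta>t B) \<eta>c)"

definition edge_prob ::
  "'a measure \<Rightarrow> ('a \<Rightarrow> real) \<Rightarrow> ('a \<Rightarrow> real) \<Rightarrow> real \<Rightarrow> real" where
  "edge_prob M \<eta>c \<eta>t B = (1 + edge M \<eta>c \<eta>t B) / 2"

text \<open>\<open>logit q / B\<close> as an extended real: the limits of the real-valued \<open>logit\<close> at 0 and 1 are \<open>-\<infinity>\<close> and \<open>\<infinity>\<close>,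
  whereas \<open>ln\<close> and division by 0 would make it vanish there.\<close>

definition alpha_star :: "real \<Rightarrow> real \<Rightarrow> ereal" where
  "alpha_star q B =
     (if q = 0 then - \<infinity> else if q = 1 then \<infinity> else ereal (logit q / B))"

text \<open>The Bayes tilted estimate. For \<open>\<alpha> = \<plusminus>\<infinity>\<close> the value is the pointwise limit of the formula; see
  \<open>tilted_tendsto_at_top\<close> and \<open>tilted_tendsto_at_bot\<close> below. Pitfall: \<open>0 powr a = 0\<close> for every \<open>a\<close>,
  so for finite \<open>\<alpha> \<le> 0\<close> the value at \<open>v \<in> {0, 1}\<close> is only conventional.\<close>

definition tilted :: "ereal \<Rightarrow> real \<Rightarrow> real" where
  "tilted \<alpha> v = (case \<alpha> of
       ereal a \<Rightarrow> v powr a / (v powr a + (1 - v) powr a)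
     | PInfty \<Rightarrow> (if v < 1/2 then 0 else if v = 1/2 then 1/2 else 1)
     | MInfty \<Rightarrow> (if v < 1/2 then 1 else if v = 1/2 then 1/2 else 0))"

text \<open>\<open>- ln u\<close> for \<open>u \<in> [0, 1]\<close>, with the value \<open>\<infinity>\<close> at 0. Together with \<open>0 * \<infinity> = 0\<close> in
  \<^typ>\<open>ennreal\<close> this gives the usual conventions for the cross-entropy, which may be infinite.\<close>

definition neg_log :: "real \<Rightarrow> ennreal" where
  "neg_log u = (if u = 0 then \<infinity> else ennreal (- ln u))"

definition cross_entropy ::
  "'a measure \<Rightarrow> ('a \<Rightarrow> real) \<Rightarrow> ('a \<Rightarrow> real) \<Rightarrow> ereal \<Rightarrow> ennreal" where
  "cross_entropy M \<eta>t \<eta>c \<alpha> =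
     (\<integral>\<^sup>+x. ennreal (\<eta>c x) * neg_log (tilted \<alpha> (\<eta>t x))
         + ennreal (1 - \<eta>c x) * neg_log (tilted \<alpha> (1 - \<eta>t x)) \<partial>M)"

text \<open>The convention \<open>0 log 0 = 0\<close> is provided by \<open>ln 0 = 0\<close>.\<close>

definition binary_entropy :: "real \<Rightarrow> real" where
  "binary_entropy u = - u * ln u - (1 - u) * ln (1 - u)"

definition cond_entropy :: "'a measure \<Rightarrow> ('a \<Rightarrow> real) \<Rightarrow> real" where
  "cond_entropy M \<eta>c = (\<integral>x. binary_entropy (\<eta>c x) \<partial>M)"

definition KL_tilted ::
  "'a measure \<Rightarrow> ('a \<Rightarrow> real) \<Rightarrow> ('a \<Rightarrow> real) \<Rightarrow> ereal \<Rightarrow> ereal" where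
  "KL_tilted M \<eta>t \<eta>c \<alpha> = enn2ereal (cross_entropy M \<eta>t \<eta>c \<alpha>) - ereal (cond_entropy M \<eta>c)"

lemma tilted_simps:
  "tilted (ereal a) v = v powr a / (v powr a + (1 - v) powr a)"
  "tilted \<infinity> v = (if v < 1/2 then 0 else if v = 1/2 then 1/2 else 1)"
  "tilted (-\<infinity>) v = (if v < 1/2 then 1 else if v = 1/2 then 1/2 else 0)"
  by (simp_all add: tilted_def flip: PInfty_eq_infinity MInfty_eq_minfinity)

lemma tilted_alt:
  assumes "0 < v" "v < 1"
  shows "tilted (ereal a) v = 1 / (1 + exp (- a * logit v))"
proof -
  have 1: "exp (- a * logit v) = (1 - v) powr a / v powr a"
    using assms by (simp add: logit_def ln_div powr_def algebra_simps flip: exp_diff)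
  have "v powr a > 0" using assms by simp
  then show ?thesis unfolding 1 tilted_simps by (simp add: field_simps)
qed

lemma logit_sign:
  assumes "0 < v" "v < 1"
  shows "logit v < 0 \<longleftrightarrow> v < 1/2" "logit v = 0 \<longleftrightarrow> v = 1/2"
  using assms by (auto simp: logit_def field_simps ln_less_zero_iff)

lemma tilted_tendsto_at_top:
  assumes "0 < v" "v < 1"
  shows "((\<lambda>a. tilted (ereal a) v) \<longlongrightarrow> tilted \<infinity> v) at_top"
proof -
  consider "logit v < 0" | "logit v = 0" | "logit v > 0" by linarith
  then show ?thesis
  proof cases
    case 1
    have "((\<lambda>a. 1 / (1 + exp (- a * logit v))) \<longlongrightarrow> 0) at_top" using 1 by real_asymp
    then show ?thesis using 1 assms logit_sign[OF assms] by (simp add: tilted_alt tilted_simps(2,3))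
  next
    case 2
    then show ?thesis using assms logit_sign[OF assms] by (simp add: tilted_alt tilted_simps(2,3))
  next
    case 3
    have "((\<lambda>a. 1 / (1 + exp (- a * logit v))) \<longlongrightarrow> 1) at_top" using 3 by real_asymp
    then show ?thesis using 3 assms logit_sign[OF assms] by (simp add: tilted_alt tilted_simps(2,3))
  qed
qed

lemma tilted_tendsto_at_bot:
  assumes "0 < v" "v < 1"
  shows "((\<lambda>a. tilted (ereal a) v) \<longlongrightarrow> tilted (-\<infinity>) v) at_bot"
proof -
  consider "logit v < 0" | "logit v = 0" | "logit v > 0" by linarith
  then show ?thesis
  proof cases
    case 1
    have "((\<lambda>a. 1 / (1 + exp (- a * logit v))) \<longlongrightarrow> 1) at_bot" using 1 by real_asymp
    then show ?thesis using 1 assms logit_sign[OF assms] by (simp add: tilted_alt tilted_simps(2,3))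
  next
    case 2
    then show ?thesis using assms logit_sign[OF assms] by (simp add: tilted_alt tilted_simps(2,3))
  next
    case 3
    have "((\<lambda>a. 1 / (1 + exp (- a * logit v))) \<longlongrightarrow> 0) at_bot" using 3 by real_asymp
    then show ?thesis using 3 assms logit_sign[OF assms] by (simp add: tilted_alt tilted_simps(2,3))
  qed
qed

lemma emeasure_joint_law:
  assumes [measurable]: "\<eta> \<in> borel_measurable N" "A \<in> sets N" and y: "y \<in> {-1, 1}"
  shows "emeasure (joint_law N \<eta>) (A \<times> {y}) =
    (\<integral>\<^sup>+x\<in>A. ennreal (if y = 1 then \<eta> x else 1 - \<eta> x) \<partial>N)"
proof -
  interpret C: sigma_finite_measure "count_space {-1, 1 :: real}"
    by (rule sigma_finite_measure_count_space_finite) simp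
  have [measurable]: "(\<lambda>(x, y). ennreal (if y = 1 then \<eta> x else 1 - \<eta> x))
      \<in> borel_measurable (N \<Otimes>\<^sub>M count_space {-1, 1 :: real})"
    by measurable
  have [measurable]: "{y} \<in> sets (count_space {-1, 1 :: real})" using y by simp
  have "emeasure (joint_law N \<eta>) (A \<times> {y}) =
      (\<integral>\<^sup>+z. (case z of (x, y') \<Rightarrow> ennreal (if y' = 1 then \<eta> x else 1 - \<eta> x)) *
         indicator (A \<times> {y}) z \<partial>(N \<Otimes>\<^sub>M count_space {-1, 1 :: real}))"
    unfolding joint_law_def by (subst emeasure_density) auto
  also have "\<dots> = (\<integral>\<^sup>+x. \<integral>\<^sup>+y'. ennreal (if y' = 1 then \<eta> x else 1 - \<eta> x) *
         indicator (A \<times> {y}) (x, y') \<partial>count_space {-1, 1 :: real} \<partial>N)"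
    by (subst C.nn_integral_fst[symmetric]) auto
  also have "\<dots> = (\<integral>\<^sup>+x\<in>A. ennreal (if y = 1 then \<eta> x else 1 - \<eta> x) \<partial>N)"
    using y by (intro nn_integral_cong) (auto simp: nn_integral_count_space_finite indicator_def)
  finally show ?thesis .
qed

lemma emeasure_joint_law_pos:
  assumes "\<eta> \<in> borel_measurable N" "A \<in> sets N"
  shows "emeasure (joint_law N \<eta>) (A \<times> {1}) = (\<integral>\<^sup>+x\<in>A. ennreal (\<eta> x) \<partial>N)"
  using emeasure_joint_law[OF assms, of 1] by simp

lemma emeasure_joint_law_neg:
  assumes "\<eta> \<in> borel_measurable N" "A \<in> sets N"
  shows "emeasure (joint_law N \<eta>) (A \<times> {-1}) = (\<integral>\<^sup>+x\<in>A. ennreal (1 - \<eta> x) \<partial>N)"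
  using emeasure_joint_law[OF assms, of "-1"] by simp

end

theory Submission
  imports Defs
begin

text \<open>Write \<open>L = logit (\<eta>t X)\<close>, so that \<open>\<bar>L\<bar> \<le> B\<close> almost surely. As \<open>ln (1 + exp z)\<close> equals
  \<open>z / 2 + ln (2 * cosh (z / 2))\<close>, the cross-entropy at \<open>a\<close> is the expectation of
  \<open>ln (2 * cosh (a * L / 2)) - a * (2 * \<eta>c X - 1) * L / 2\<close>. Monotonicity of \<open>cosh\<close> bounds it by
  \<open>ln (2 * cosh (a * B / 2)) - a * B * e / 2\<close> with \<open>e\<close> the edge, which is the entropy of \<open>q\<close> when
  \<open>a * B = logit q\<close>. If \<open>q\<close> is 0 or 1, then \<open>(2 * \<eta>c X - 1) * L\<close> attains its extreme value
  \<open>-B\<close> or \<open>B\<close> almost surely, so the tilted posterior is almost surely correct and the cross-entropy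
  vanishes.\<close>

text \<open>Factoring \<open>exp (z / 2)\<close> out of \<open>1 + exp z\<close> splits the logistic
  loss into a linear part and a part even in \<open>z\<close>.\<close>

lemma ln_one_plus_exp: "ln (1 + exp z) = z / 2 + ln (2 * cosh (z / 2))" for z :: real
proof -
  have "1 + exp z = exp (z / 2) * (2 * cosh (z / 2))"
    by (simp add: cosh_def ring_distribs flip: exp_add)
  then show ?thesis
    using cosh_real_pos[of "z / 2"] by (simp add: ln_mult del: cosh_real_pos)
qed

text \<open>The two bounds are the values at \<open>-B\<close> and \<open>B\<close> of the logistic
  function, the increasing inverse of \<open>logit\<close>.\<close>

lemma abs_logit_le:
  assumes "inverse (1 + exp B) \<le> v" "v \<le> inverse (1 + exp (- B))"
  shows "0 < v" "v < 1" "\<bar>logit v\<bar> \<le> B"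
proof -
  have "0 < inverse (1 + exp B)"
    by (simp add: add_pos_pos)
  then show v0: "0 < v" using assms(1) by linarith
  have "inverse (1 + exp (- B)) < 1"
    by (rule inverse_less_1_iff[THEN iffD2]) (simp add: add_pos_pos)
  then show v1: "v < 1" using assms(2) by linarith
  have p: "0 < v / (1 - v)" using v0 v1 by simp
  have "v / (1 - v) \<le> exp B"
  proof -
    have "inverse (1 + exp (- B)) = exp B / (1 + exp B)"
      by (simp add: exp_minus divide_simps add_pos_pos add_eq_0_iff)
    then have "v * (1 + exp B) \<le> exp B"
      using assms(2) by (simp add: pos_le_divide_eq add_pos_pos)
    then show ?thesis using v1 by (simp add: pos_divide_le_eq algebra_simps)
  qed
  then have "logit v \<le> B"
    unfolding logit_def using p by (metis ln_exp ln_le_cancel_iff exp_gt_zero)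
  moreover have "exp (- B) \<le> v / (1 - v)"
  proof -
    have "1 \<le> v * (1 + exp B)"
      using assms(1) by (simp add: inverse_eq_divide pos_divide_le_eq add_pos_pos)
    then have "exp (- B) * 1 \<le> exp (- B) * (v * (1 + exp B))"
      by (intro mult_left_mono) auto
    then have "exp (- B) \<le> v * exp (- B) + v"
      by (simp add: algebra_simps flip: exp_add)
    then show ?thesis using v1 by (simp add: pos_le_divide_eq algebra_simps)
  qed
  then have "- B \<le> logit v"
    unfolding logit_def using p by (metis ln_exp ln_le_cancel_iff exp_gt_zero)
  ultimately show "\<bar>logit v\<bar> \<le> B" by linarith
qed

text \<open>Tilting by \<open>a\<close> multiplies the logit by \<open>a\<close>, which turns the
  log-loss into a logistic loss. For \<open>v\<close> strictly between 0 and 1 the tilted value is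
  positive, so the infinite branch of \<open>neg_log\<close> is avoided.\<close>

lemma neg_log_tilted:
  assumes "0 < v" "v < 1"
  shows "neg_log (tilted (ereal a) v) = ennreal (ln (1 + exp (- a * logit v)))"
  using assms add_pos_pos[OF zero_less_one exp_gt_zero[of "- a * logit v"]]
  by (simp add: neg_log_def tilted_alt ln_div)

lemma logit_one_minus:
  assumes "0 < v" "v < 1"
  shows "logit (1 - v) = - logit v"
  using assms by (simp add: logit_def ln_div)

text \<open>Identifies the final bound at \<open>a * B = logit q\<close> as an entropy, using
  \<open>1 + exp (logit q) = 1 / (1 - q)\<close>.\<close>

lemma binary_entropy_logit:
  assumes "0 < q" "q < 1"
  shows "binary_entropy q = ln (2 * cosh (logit q / 2)) - (2 * q - 1) * logit q / 2"
proof -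
  have "1 + exp (logit q) = 1 / (1 - q)"
    using assms by (simp add: logit_def field_simps)
  then have "ln (2 * cosh (logit q / 2)) = - ln (1 - q) - logit q / 2"
    using ln_one_plus_exp[of "logit q"] assms by (simp add: ln_div)
  then show ?thesis
    using assms by (simp add: binary_entropy_def logit_def ln_div field_simps)
qed

text \<open>Fubini for \<open>N\<close> times counting measure. The weight is at most 1 and the
  product measure is finite, so the almost sure bound \<open>C\<close> gives integrability.\<close>

lemma integral_joint_law:
  fixes f :: "'a \<times> real \<Rightarrow> real"
  assumes "prob_space N"
    and [measurable]: "\<eta> \<in> borel_measurable N" "f \<in> borel_measurable (N \<Otimes>\<^sub>M count_space {-1, 1})"
    and \<eta>: "\<And>x. x \<in> space N \<Longrightarrow> \<eta> x \<in> {0..1}"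
    and bound: "AE x in N. \<bar>f (x, 1)\<bar> \<le> C \<and> \<bar>f (x, -1)\<bar> \<le> C"
  shows "(\<integral>z. f z \<partial>joint_law N \<eta>) = (\<integral>x. \<eta> x * f (x, 1) + (1 - \<eta> x) * f (x, -1) \<partial>N)"
proof -
  interpret prob_space N by fact
  let ?C = "count_space {-1, 1 :: real}"
  interpret C: finite_measure ?C by (rule finite_measure_count_space) simp
  interpret P: pair_sigma_finite N ?C ..
  interpret F: finite_measure "N \<Otimes>\<^sub>M ?C" by (rule finite_measure_pair_measure) unfold_locales
  let ?w = "\<lambda>z :: 'a \<times> real. if snd z = 1 then \<eta> (fst z) else 1 - \<eta> (fst z)"
  have [measurable]: "?w \<in> borel_measurable (N \<Otimes>\<^sub>M ?C)"
    by measurable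
  have w: "0 \<le> ?w z" "?w z \<le> 1" if "z \<in> space (N \<Otimes>\<^sub>M ?C)" for z
    using \<eta>[of "fst z"] that by (auto simp: space_pair_measure)
  have "AE z in N \<Otimes>\<^sub>M ?C. \<bar>f z\<bar> \<le> C"
    by (rule P.AE_pair_measure) (use bound in \<open>auto simp: AE_count_space\<close>)
  then have "AE z in N \<Otimes>\<^sub>M ?C. norm (?w z * f z) \<le> C"
  proof (rule AE_mp, intro AE_I2 impI)
    fix z assume "z \<in> space (N \<Otimes>\<^sub>M ?C)" "\<bar>f z\<bar> \<le> C"
    then show "norm (?w z * f z) \<le> C"
      using mult_mono[of "?w z" 1 "\<bar>f z\<bar>" C] w[of z] unfolding real_norm_def abs_mult by simp
  qed
  then have int: "integrable (N \<Otimes>\<^sub>M ?C) (\<lambda>z. ?w z * f z)"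
    by (intro F.integrable_const_bound) simp_all
  have "(\<integral>z. f z \<partial>joint_law N \<eta>) = (\<integral>z. ?w z * f z \<partial>(N \<Otimes>\<^sub>M ?C))"
    unfolding joint_law_def case_prod_beta
    by (subst integral_density) (use w in \<open>auto intro!: AE_I2 split del: if_split\<close>)
  also have "\<dots> = (\<integral>x. \<integral>y. ?w (x, y) * f (x, y) \<partial>?C \<partial>N)"
    using P.integral_fst'[OF int] by simp
  also have "\<dots> = (\<integral>x. \<eta> x * f (x, 1) + (1 - \<eta> x) * f (x, -1) \<partial>N)"
    by (intro Bochner_Integration.integral_cong refl)
       (simp add: lebesgue_integral_count_space_finite)
  finally show ?thesis .
qed

lemma AE_clip_support:
  assumes "prob_space M" and [measurable]: "\<eta>t \<in> borel_measurable M"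
    and "clip_weight M \<eta>t B = 1"
  shows "AE x in M. x \<in> clip_support M \<eta>t B"
proof -
  interpret prob_space M by fact
  have "clip_support M \<eta>t B \<in> events"
    unfolding clip_support_def by measurable
  then show ?thesis
    using assms(3) by (simp add: clip_weight_def prob_eq_1)
qed

text \<open>Conditioning on an event of probability 1 changes nothing: the conditional density is
  almost surely 1.\<close>

lemma clip_marginal_full:
  assumes "prob_space M" and [measurable]: "\<eta>t \<in> borel_measurable M"
    and "clip_weight M \<eta>t B = 1"
  shows "clip_marginal M \<eta>t B = M"
proof -
  interpret prob_space M by fact
  have [measurable]: "clip_support M \<eta>t B \<in> events"
    unfolding clip_support_def by measurable
  have "clip_marginal M \<eta>t B = density M (\<lambda>_. 1)"
    unfolding clip_marginal_def uniform_measure_def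
    using AE_clip_support[OF assms] assms(3)
    by (intro density_cong) (auto simp: clip_weight_def emeasure_eq_measure)
  then show ?thesis by (simp add: density_1)
qed

text \<open>The gap \<open>c - f\<close> is nonnegative with integral 0, hence vanishes almost
  surely.\<close>

lemma (in prob_space) AE_eq_upper_bound:
  fixes f :: "'a \<Rightarrow> real"
  assumes "integrable M f" "AE x in M. f x \<le> c" "expectation f = c"
  shows "AE x in M. f x = c"
proof -
  have "(\<integral>x. c - f x \<partial>M) = 0"
    using assms(1,3) by (simp add: prob_space)
  then have "AE x in M. c - f x = 0"
    using assms by (subst integral_nonneg_eq_0_iff_AE[symmetric]) auto
  then show ?thesis by (rule AE_mp) simp
qed

text \<open>The factors have absolute values at most 1 and \<open>B\<close>, so the product reaches
  \<open>B\<close> only if \<open>2 * c - 1\<close> is 1 or -1; then \<open>l\<close> must share its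
  sign.\<close>

lemma weight_product_extreme:
  fixes B c l :: real
  assumes "0 < B" "0 \<le> c" "c \<le> 1" "\<bar>l\<bar> \<le> B" "(2 * c - 1) * l = B"
  shows "c = 1 \<and> 0 < l \<or> c = 0 \<and> l < 0"
proof -
  have "\<bar>2 * c - 1\<bar> * \<bar>l\<bar> = B"
    using assms by (simp flip: abs_mult)
  moreover have "\<bar>2 * c - 1\<bar> * \<bar>l\<bar> \<le> \<bar>2 * c - 1\<bar> * B"
    using assms by (intro mult_left_mono) auto
  ultimately have "1 \<le> \<bar>2 * c - 1\<bar>"
    using assms(1) by simp
  then have "c = 0 \<or> c = 1"
    using assms(2,3) by linarith
  then show ?thesis using assms by auto
qed

theorem theorem10:
  fixes M :: "'a measure" and \<eta>c \<eta>t :: "'a \<Rightarrow> real" and B q :: real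
  assumes "prob_space M"
    and "\<eta>c \<in> borel_measurable M" and "\<eta>t \<in> borel_measurable M"
    and "\<And>x. x \<in> space M \<Longrightarrow> \<eta>c x \<in> {0..1}"
    and "\<And>x. x \<in> space M \<Longrightarrow> \<eta>t x \<in> {0..1}"
    and "B > 0"
    and "clip_weight M \<eta>t B = 1"
    and "q = edge_prob M \<eta>c \<eta>t B"
  shows "KL_tilted M \<eta>t \<eta>c (alpha_star q B) \<le> ereal (binary_entropy q - cond_entropy M \<eta>c)"
proof -
  interpret prob_space M by fact
  note [measurable] = assms(2,3)
  define L where "L x = logit (\<eta>t x)" for x
  \<comment> \<open>\<open>g x\<close> is the conditional mean of \<open>Y * L\<close> given
    \<open>X = x\<close>.\<close>
  define g where "g x = (2 * \<eta>c x - 1) * L x" for x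
  have [measurable]: "L \<in> borel_measurable M" "g \<in> borel_measurable M"
    unfolding g_def L_def logit_def by measurable
  have supp: "AE x in M. 0 < \<eta>t x \<and> \<eta>t x < 1 \<and> \<bar>L x\<bar> \<le> B \<and> 0 \<le> \<eta>c x \<and> \<eta>c x \<le> 1"
    using AE_clip_support[OF assms(1,3,7)]
  proof (rule AE_mp, intro AE_I2 impI)
    fix x assume "x \<in> space M" "x \<in> clip_support M \<eta>t B"
    then show "0 < \<eta>t x \<and> \<eta>t x < 1 \<and> \<bar>L x\<bar> \<le> B \<and> 0 \<le> \<eta>c x \<and> \<eta>c x \<le> 1"
      using abs_logit_le[of B "\<eta>t x"] assms(4)[of x] by (simp add: clip_support_def L_def)
  qed
  have g_le: "AE x in M. \<bar>g x\<bar> \<le> B"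
    using supp
  proof (rule AE_mp, intro AE_I2 impI)
    fix x assume "0 < \<eta>t x \<and> \<eta>t x < 1 \<and> \<bar>L x\<bar> \<le> B \<and> 0 \<le> \<eta>c x \<and> \<eta>c x \<le> 1"
    then show "\<bar>g x\<bar> \<le> B"
      using mult_mono[of "\<bar>2 * \<eta>c x - 1\<bar>" 1 "\<bar>L x\<bar>" B] by (simp add: g_def abs_mult abs_le_iff)
  qed
  then have g_int: "integrable M g"
    by (intro integrable_const_bound[of _ B]) simp_all
  have [measurable]: "(\<lambda>z. snd z * logit (\<eta>t (fst z))) \<in> borel_measurable (M \<Otimes>\<^sub>M count_space {-1, 1})"
    unfolding logit_def
    by (intro borel_measurable_times measurable_compose[OF measurable_snd]) simp_all
  have "(\<integral>z. snd z * logit (\<eta>t (fst z)) \<partial>joint_law M \<eta>c) =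
      (\<integral>x. \<eta>c x * L x + (1 - \<eta>c x) * (- L x) \<partial>M)"
    using supp
    by (subst integral_joint_law[where C = B])
       (use assms in \<open>auto simp: L_def elim: AE_mp\<close>)
  also have "\<dots> = expectation g"
    by (intro Bochner_Integration.integral_cong refl) (simp add: g_def algebra_simps)
  finally have Eg: "expectation g = B * (2 * q - 1)"
    using assms(6) by (simp add: assms(8) edge_prob_def edge_def clip_marginal_full[OF assms(1,3,7)] field_simps)
  have "expectation g \<le> B" "- B \<le> expectation g"
    using g_le g_int by (auto intro!: integral_le_const integral_ge_const elim: AE_mp)
  then have q: "0 \<le> q" "q \<le> 1"
    using assms(6) unfolding Eg by (simp_all add: algebra_simps zero_le_mult_iff)
  \<comment> \<open>Nonnegativity is carried along because \<open>ennreal\<close> truncates negative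
    numbers to 0; it allows the return to \<open>ereal\<close> at the end.\<close>
  have "cross_entropy M \<eta>t \<eta>c (alpha_star q B) \<le> ennreal (binary_entropy q) \<and> 0 \<le> binary_entropy q"
  proof (cases "q = 0 \<or> q = 1")
    case True
    \<comment> \<open>The sign of the infinite exponent. With it both cases read alike:
      \<open>s * g\<close> has mean \<open>B\<close>, its almost sure upper bound.\<close>
    define s :: real where "s = (if q = 0 then -1 else 1)"
    have "AE x in M. s * g x = B"
      using g_le g_int Eg True by (intro AE_eq_upper_bound) (auto simp: s_def elim: AE_mp)
    then have "AE x in M. ennreal (\<eta>c x) * neg_log (tilted (alpha_star q B) (\<eta>t x))
         + ennreal (1 - \<eta>c x) * neg_log (tilted (alpha_star q B) (1 - \<eta>t x)) = 0"
      using supp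
    proof eventually_elim
      case (elim x)
      \<comment> \<open>The sign of \<open>s * L x\<close> decides which label the limiting estimate
        gives probability 1. That label is the certain one; the other has infinite loss but weight
        0, and \<open>0 * \<infinity> = 0\<close>.\<close>
      have "\<eta>c x = 1 \<and> 0 < s * L x \<or> \<eta>c x = 0 \<and> s * L x < 0"
        using elim assms(6)
        by (intro weight_product_extreme[of B]) (auto simp: g_def s_def algebra_simps)
      then show ?case
        using True logit_sign[of "\<eta>t x"] elim
        by (auto simp: s_def L_def alpha_star_def tilted_simps neg_log_def split: if_splits)
    qed
    then have "cross_entropy M \<eta>t \<eta>c (alpha_star q B) = 0"
      unfolding cross_entropy_def by (subst nn_integral_cong_AE[where v = "\<lambda>_. 0"]) auto
    then show ?thesis using True by (auto simp: binary_entropy_def)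
  next
    case False
    define a where "a = logit q / B"
    \<comment> \<open>The pointwise bound is affine in \<open>g\<close>, so its expectation is
      determined by \<open>q\<close> and \<open>B\<close>.\<close>
    define h where "h x = ln (2 * cosh (a * B / 2)) - a / 2 * g x" for x
    have h_int: "integrable M h"
      unfolding h_def using g_int by simp
    have Eh: "expectation h = binary_entropy q"
      unfolding h_def using False q g_int assms(6)
      by (simp add: prob_space Eg binary_entropy_logit a_def)
    have h_ge: "AE x in M. 0 \<le> h x \<and>
        ennreal (\<eta>c x) * neg_log (tilted (ereal a) (\<eta>t x))
         + ennreal (1 - \<eta>c x) * neg_log (tilted (ereal a) (1 - \<eta>t x)) \<le> ennreal (h x)"
      using supp
    proof eventually_elim
      case (elim x)
      \<comment> \<open>\<open>a\<close> and \<open>L x\<close> may be negative; \<open>cosh\<close>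
        is even and increasing on the nonnegative reals.\<close>
      have "cosh (a * L x / 2) \<le> cosh (a * B / 2)"
      proof -
        have "\<bar>a * L x / 2\<bar> \<le> \<bar>a * B / 2\<bar>"
          using elim assms(6) by (simp add: abs_mult mult_left_mono)
        then have "cosh \<bar>a * L x / 2\<bar> \<le> cosh \<bar>a * B / 2\<bar>"
          by (subst cosh_real_nonneg_le_iff) auto
        then show ?thesis by (simp only: cosh_real_abs)
      qed
      then have le: "ln (2 * cosh (a * L x / 2)) \<le> ln (2 * cosh (a * B / 2))"
        by simp
      let ?k = "\<eta>c x * ln (1 + exp (- a * L x)) + (1 - \<eta>c x) * ln (1 + exp (a * L x))"
      have nn: "0 \<le> \<eta>c x * ln (1 + exp (- a * L x))" "0 \<le> (1 - \<eta>c x) * ln (1 + exp (a * L x))"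
        using elim by simp_all
      \<comment> \<open>The even parts of both losses agree and their weights sum to 1; the linear
        parts combine to \<open>- a / 2 * g x\<close>.\<close>
      have "?k = ln (2 * cosh (a * L x / 2)) - a / 2 * g x"
        unfolding ln_one_plus_exp by (simp add: g_def field_simps)
      then have "?k \<le> h x" using le by (simp add: h_def)
      moreover have "ennreal (\<eta>c x) * neg_log (tilted (ereal a) (\<eta>t x))
         + ennreal (1 - \<eta>c x) * neg_log (tilted (ereal a) (1 - \<eta>t x)) = ennreal ?k"
        using elim nn
        by (simp add: neg_log_tilted logit_one_minus L_def ennreal_mult ennreal_plus)
      ultimately show ?case using nn by (simp add: ennreal_leI del: ennreal_plus)
    qed
    have "cross_entropy M \<eta>t \<eta>c (ereal a) \<le> (\<integral>\<^sup>+x. ennreal (h x) \<partial>M)"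
      unfolding cross_entropy_def using h_ge by (intro nn_integral_mono_AE) auto
    also have "\<dots> = ennreal (binary_entropy q)"
      using h_int h_ge Eh by (subst nn_integral_eq_integral) auto
    finally have "cross_entropy M \<eta>t \<eta>c (ereal a) \<le> ennreal (binary_entropy q)" .
    moreover have "0 \<le> binary_entropy q"
      unfolding Eh[symmetric] using h_ge by (intro integral_nonneg_AE) auto
    ultimately show ?thesis using False by (simp add: alpha_star_def a_def)
  qed
  then have "enn2ereal (cross_entropy M \<eta>t \<eta>c (alpha_star q B)) \<le> ereal (binary_entropy q)"
    by (metis enn2ereal_ennreal less_eq_ennreal.rep_eq)
  then show ?thesis
    unfolding KL_tilted_def by (metis ereal_minus(1) ereal_minus_mono order_refl)
qed

end
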